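(* For every positive even integer $n$, $$\left[A_{n,1/3}^{-1}\right] = \left[2\left(n-\tfrac{1}{2}\right)^{1/3}\right],$$ and for every positive odd integer $n$, $$\left[B_{n,1/3}^{-1}\right] = \left[-2\left(n-\tfrac{1}{2}\right)^{1/3}\right].$$
   Context: For a positive integer $n$ and real $0<s<1$, define $A_{n,s} = \sum_{j=0}^{\infty}\left(\frac{1}{(n+2j)^s}-\frac{1}{(n+2j+1)^s}\right)$ and $B_{n,s} = \sum_{j=0}^{\infty}\left(-\frac{1}{(n+2j)^s}+\frac{1}{(n+2j+1)^s}\right)$. Here $A_{n,s}^{-1}=1/A_{n,s}$, $B_{n,s}^{-1}=1/B_{n,s}$, and $[x]$ denotes the greatest integer less than or equal to $x$. *)

theory Defs
  imports "HOL-Analysis.Analysis"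
begin

(* Both series are summed over the bracketed pairs. For n > 0 and 0 < s < 1 all brackets
   have the same sign and the series converge, so suminf is their genuine sum. *)

definition A :: "nat \<Rightarrow> real \<Rightarrow> real" where
  "A n s = (\<Sum>j. 1 / real (n + 2 * j) powr s - 1 / real (n + 2 * j + 1) powr s)"

definition B :: "nat \<Rightarrow> real \<Rightarrow> real" where
  "B n s = (\<Sum>j. - (1 / real (n + 2 * j) powr s) + 1 / real (n + 2 * j + 1) powr s)"

end

theory Submission
  imports Defs
begin

text \<open>
  Write \<open>f x = 1 / x powr s\<close>. As \<open>- f'\<close> is convex, comparing its averages over two concentric
  intervals gives \<open>f n - f (n+1) \<le> (f (n-1/2) - f (n+3/2)) / 2\<close>, which telescopes to
  \<open>A n s \<le> f (n-1/2) / 2\<close>. Together with \<open>A n s + A (n+1) s = f n\<close> this yields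
  \<open>A n s \<ge> f n - f (n+1/2) / 2\<close>. For \<open>s = 1/3\<close> the two bounds place \<open>(1 / A n s) ^ 3\<close> in
  \<open>[8n - 4, 8n - 3)\<close> once \<open>n \<ge> 4\<close>; the only integer there, \<open>8n - 4\<close>, is not a cube.
\<close>

section \<open>Convexity of negative powers\<close>

lemma convex_on_powr_neg:
  fixes p :: real
  assumes "p > 0"
  shows "convex_on {0<..} (\<lambda>x. x powr (-p))"
proof (rule f''_ge0_imp_convex)
  fix x :: real assume "x \<in> {0<..}"
  then have x: "x > 0" by simp
  show "((\<lambda>x. x powr (-p)) has_real_derivative (-p) * x powr (-p - 1)) (at x)"
    using x by (auto intro!: derivative_eq_intros)
  show "((\<lambda>x. (-p) * x powr (-p - 1)) has_real_derivative (-p) * ((-p - 1) * x powr (-p - 2))) (at x)"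
    using x by (auto intro!: derivative_eq_intros simp: algebra_simps)
  show "0 \<le> (-p) * ((-p - 1) * x powr (-p - 2))"
    using assms by (intro mult_nonpos_nonpos mult_nonpos_nonneg) auto
qed auto

text \<open>Both sides vanish at \<open>t = 0\<close>, so it suffices that their difference
  \<open>D\<close> is nondecreasing. Its derivative compares the convex \<open>h\<close> at
  \<open>c - u\<close>, \<open>c + u\<close> with \<open>h\<close> at \<open>c - u/2\<close>,
  \<open>c + u/2\<close>; the inner points are convex combinations of the outer ones with weights
  3/4, 1/4 and 1/4, 3/4, and the two convexity bounds add up to
  \<open>h (c - u) + h (c + u)\<close>.\<close>

lemma powr_neg_diff_half_le:
  fixes s c t :: real
  assumes s: "s > 0" and t: "0 \<le> t" "t < c"
  shows "2 * ((c - t/2) powr (-s) - (c + t/2) powr (-s)) \<le> (c - t) powr (-s) - (c + t) powr (-s)"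
proof -
  define D where "D u = (c - u) powr (-s) - (c + u) powr (-s)
    - 2 * ((c - u/2) powr (-s) - (c + u/2) powr (-s))" for u
  define h where "h y = y powr (-(s + 1))" for y :: real
  have conv: "convex_on {0<..} h"
    using convex_on_powr_neg[of "s + 1"] s by (simp add: h_def[abs_def])
  have "D 0 \<le> D t"
  proof (rule DERIV_nonneg_imp_nondecreasing[OF t(1)])
    fix u assume u: "0 \<le> u" "u \<le> t"
    with t have pos: "c - u > 0" "c + u > 0" "c - u/2 > 0" "c + u/2 > 0" by auto
    have "(D has_real_derivative s * (h (c - u) + h (c + u) - h (c - u/2) - h (c + u/2))) (at u)"
      unfolding D_def[abs_def] h_def using pos
      by (auto intro!: derivative_eq_intros simp: algebra_simps minus_diff_commute)
    moreover have "h (c - u/2) \<le> (1 - 1/4) * h (c - u) + (1/4) * h (c + u)"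
    proof -
      have "c - u/2 = (1 - 1/4) *\<^sub>R (c - u) + (1/4) *\<^sub>R (c + u)"
        by (simp add: field_simps)
      then show ?thesis
        using convex_onD[OF conv, of "1/4" "c - u" "c + u"] pos by simp
    qed
    moreover have "h (c + u/2) \<le> (1 - 3/4) * h (c - u) + (3/4) * h (c + u)"
    proof -
      have "c + u/2 = (1 - 3/4) *\<^sub>R (c - u) + (3/4) *\<^sub>R (c + u)"
        by (simp add: field_simps)
      then show ?thesis
        using convex_onD[OF conv, of "3/4" "c - u" "c + u"] pos by simp
    qed
    ultimately show "\<exists>y. (D has_real_derivative y) (at u) \<and> 0 \<le> y"
      using s by (intro exI[of _ "s * (h (c - u) + h (c + u) - h (c - u/2) - h (c + u/2))"]) auto
  qed
  then show ?thesis by (simp add: D_def)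
qed

section \<open>Telescoping bounds for the alternating series\<close>

lemma inverse_powr_shift_tendsto_0:
  fixes s c :: real
  assumes "s > 0"
  shows "(\<lambda>j. 1 / (real (2 * j) + c) powr s) \<longlonglongrightarrow> 0"
proof -
  have "strict_mono (\<lambda>j. 2 * j :: nat)"
    by (simp add: strict_mono_def)
  then have "filterlim (\<lambda>j. real (2 * j)) at_top sequentially"
    by (intro filterlim_compose[OF filterlim_real_sequentially] filterlim_subseq)
  then have "filterlim (\<lambda>j. c + real (2 * j)) at_top sequentially"
    by (rule filterlim_tendsto_add_at_top[OF tendsto_const])
  then have "filterlim (\<lambda>j. real (2 * j) + c) at_top sequentially"
    by (simp only: add.commute)
  then have "(\<lambda>j. (real (2 * j) + c) powr (-s)) \<longlonglongrightarrow> 0"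
    using assms by (intro tendsto_neg_powr) auto
  then show ?thesis by (simp add: powr_minus_divide)
qed

lemma A_term_bounds:
  fixes s :: real
  assumes "s > 0" and "n > 0"
  shows "0 \<le> 1 / real n powr s - 1 / real (n + 1) powr s"
    and "1 / real n powr s - 1 / real (n + 1) powr s
      \<le> (1 / (real n - 1/2) powr s - 1 / (real n + 3/2) powr s) / 2"
proof -
  show "0 \<le> 1 / real n powr s - 1 / real (n + 1) powr s"
    using assms by (auto intro!: divide_left_mono powr_mono2)
  show "1 / real n powr s - 1 / real (n + 1) powr s
      \<le> (1 / (real n - 1/2) powr s - 1 / (real n + 3/2) powr s) / 2"
  proof -
    \<comment> \<open>Centre \<open>n + 1/2\<close> and \<open>t = 1\<close>: the inner interval is
      from \<open>n\<close> to \<open>n + 1\<close>, the outer from \<open>n - 1/2\<close> to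
      \<open>n + 3/2\<close>.\<close>
    have "real n + 1/2 - 1 = real n - 1/2" "real n + 1/2 + 1 = real n + 3/2"
      "real n + 1/2 - 1/2 = real n" "real n + 1/2 + 1/2 = real (n + 1)"
      by simp_all
    with powr_neg_diff_half_le[of s 1 "real n + 1/2"] assms show ?thesis
      by (simp only: powr_minus_divide) simp
  qed
qed

lemma
  fixes s :: real
  assumes s: "s > 0" and n: "n > 0"
  shows summable_A: "summable (\<lambda>j. 1 / real (n + 2 * j) powr s - 1 / real (n + 2 * j + 1) powr s)"
    and A_le: "A n s \<le> 1 / (2 * (real n - 1/2) powr s)"
proof -
  let ?a = "\<lambda>j. 1 / real (n + 2 * j) powr s - 1 / real (n + 2 * j + 1) powr s"
  \<comment> \<open>The outer intervals have length 2, the step of the series, so they abut and the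
    bounds telescope.\<close>
  define g where "g j = 1 / (real (2 * j) + (real n - 1/2)) powr s / 2" for j
  have "g \<longlonglongrightarrow> 0"
    unfolding g_def[abs_def] using tendsto_divide[OF inverse_powr_shift_tendsto_0[OF s] tendsto_const, of 2]
    by simp
  then have sums: "(\<lambda>j. g j - g (Suc j)) sums g 0"
    using telescope_sums'[of g 0] by simp
  have le: "?a j \<le> g j - g (Suc j)" for j
    using A_term_bounds(2)[OF s, of "n + 2 * j"] n by (simp add: g_def algebra_simps diff_divide_distrib)
  have nonneg: "0 \<le> ?a j" for j
    using A_term_bounds(1)[OF s, of "n + 2 * j"] n by simp
  show summable: "summable ?a"
    by (rule summable_comparison_test'[OF sums_summable[OF sums]]) (use le nonneg in auto)
  have "A n s \<le> g 0"
    unfolding A_def using sums_le[OF le summable_sums[OF summable] sums] .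
  then show "A n s \<le> 1 / (2 * (real n - 1/2) powr s)"
    by (simp add: g_def)
qed

text \<open>The negative term of each pair in \<open>A n s\<close> cancels the positive term of the
  matching pair in \<open>A (Suc n) s\<close>; what is left telescopes. An upper bound at
  \<open>Suc n\<close> thus becomes a lower bound at \<open>n\<close>.\<close>

lemma A_add_A_Suc:
  fixes s :: real
  assumes s: "s > 0" and n: "n > 0"
  shows "A n s + A (Suc n) s = 1 / real n powr s"
proof -
  define g where "g j = 1 / (real (2 * j) + real n) powr s" for j
  have "g \<longlonglongrightarrow> 0"
    unfolding g_def[abs_def] by (rule inverse_powr_shift_tendsto_0[OF s])
  then have "(\<lambda>j. g j - g (Suc j)) sums g 0"
    using telescope_sums'[of g 0] by simp
  moreover have "(\<lambda>j. (1 / real (n + 2 * j) powr s - 1 / real (n + 2 * j + 1) powr s)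
      + (1 / real (Suc n + 2 * j) powr s - 1 / real (Suc n + 2 * j + 1) powr s))
      sums (A n s + A (Suc n) s)"
    unfolding A_def using s n by (intro sums_add summable_sums summable_A) auto
  then have "(\<lambda>j. g j - g (Suc j)) sums (A n s + A (Suc n) s)"
    by (simp add: g_def algebra_simps)
  ultimately show ?thesis
    by (metis sums_unique2 g_def add_0 mult_0_right of_nat_0)
qed

lemma A_ge:
  fixes s :: real
  assumes "s > 0" and "n > 0"
  shows "1 / real n powr s - 1 / (2 * (real n + 1/2) powr s) \<le> A n s"
  using A_add_A_Suc[OF assms] A_le[OF assms(1), of "Suc n"] by (simp add: algebra_simps)

lemma B_eq_uminus_A:
  assumes "s > 0" and "n > 0"
  shows "B n s = - A n s"
  unfolding A_def B_def using suminf_minus[OF summable_A[OF assms]] by simp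

section \<open>Estimates for the exponent 1/3\<close>

lemma cube_powr_third:
  fixes x :: real
  assumes "x > 0"
  shows "(x powr (1/3)) ^ 3 = x"
  using assms by (simp add: powr_power)

text \<open>Cubing reduces a bound on an inverse cube root to a polynomial inequality.\<close>

lemma inverse_powr_third_less:
  fixes x c :: real
  assumes "x > 0" and "c > 0" and "1 < c ^ 3 * x"
  shows "1 / x powr (1/3) < c"
proof -
  have "1 ^ 3 < (c * x powr (1/3)) ^ 3"
    using assms by (simp add: power_mult_distrib cube_powr_third)
  then have "1 < c * x powr (1/3)"
    by (rule power_less_imp_less_base) (use assms(1,2) in simp)
  then show ?thesis
    using assms by (simp add: divide_less_eq)
qed

lemma less_inverse_powr_third:
  fixes x c :: real
  assumes "x > 0" and "c > 0" and "c ^ 3 * x < 1"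
  shows "c < 1 / x powr (1/3)"
proof -
  have "(c * x powr (1/3)) ^ 3 < 1 ^ 3"
    using assms by (simp add: power_mult_distrib cube_powr_third)
  then have "c * x powr (1/3) < 1"
    by (rule power_less_imp_less_base) auto
  then show ?thesis
    using assms by (simp add: less_divide_eq)
qed

text \<open>After division by the right-hand side's \<open>1 / x powr (1/3)\<close>, the two terms on the left are at
  most \<open>1 - 7t/6\<close> and \<open>1 + 7t/6\<close> for \<open>t = 1 / (8 x)\<close>.\<close>

lemma inverse_powr_third_add_less:
  fixes x :: real
  assumes "x \<ge> 4"
  shows "1 / (x + 1/2) powr (1/3) + 1 / (x - 3/8) powr (1/3) < 2 / x powr (1/3)"
proof -
  define t where "t = 1 / (8 * x)"
  have t: "0 < t" "t \<le> 1/32" and x: "x > 0"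
    using assms by (auto simp: t_def field_simps)
  have eqs: "x + 1/2 = x * (1 + 4 * t)" "x - 3/8 = x * (1 - 3 * t)"
    using x by (auto simp: t_def field_simps)
  have tt: "t * t \<le> t / 32"
    using mult_left_mono[OF t(2), of t] t by simp
  have ttt: "t * t * t \<le> t / 32 / 32"
    using mult_mono[OF tt t(2)] t by simp
  have tttt: "0 \<le> t * t * t" "t * t * t * t \<le> t / 32 / 32 / 32"
    using mult_mono[OF ttt t(2)] t by auto
  \<comment> \<open>To first order the two inverse roots are \<open>1 - 4*t/3\<close> and
    \<open>1 + t\<close>. The slope 7/6 is midway between 4/3 and 1, which leaves the same slack
    \<open>t/2\<close> in both products; \<open>t \<le> 1/32\<close> lets it absorb the higher
    terms.\<close>
  have "(1 - 7*t/6) ^ 3 * (1 + 4 * t)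
      = 1 + t/2 - 119/12 * (t * t) + 3185/216 * (t * t * t) - 343/54 * (t * t * t * t)"
    by (simp add: power3_eq_cube field_simps)
  then have "1 < (1 - 7*t/6) ^ 3 * (1 + 4 * t)"
    using t tt ttt tttt by linarith
  then have "1 / (1 + 4 * t) powr (1/3) < 1 - 7*t/6"
    using t by (intro inverse_powr_third_less) auto
  moreover have "(1 + 7*t/6) ^ 3 * (1 - 3 * t)
      = 1 + t/2 - 77/12 * (t * t) - 2303/216 * (t * t * t) - 343/72 * (t * t * t * t)"
    by (simp add: power3_eq_cube field_simps)
  then have "1 < (1 + 7*t/6) ^ 3 * (1 - 3 * t)"
    using t tt ttt tttt by linarith
  then have "1 / (1 - 3 * t) powr (1/3) < 1 + 7*t/6"
    using t by (intro inverse_powr_third_less) auto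
  ultimately have "1 / (1 + 4 * t) powr (1/3) + 1 / (1 - 3 * t) powr (1/3) < 2"
    by simp
  then have "(1 / (1 + 4 * t) powr (1/3) + 1 / (1 - 3 * t) powr (1/3)) / x powr (1/3) < 2 / x powr (1/3)"
    using x by (intro divide_strict_right_mono) auto
  then show ?thesis
    unfolding eqs using x t by (simp add: powr_mult add_divide_distrib mult.commute)
qed

lemma A_third_pos_le:
  assumes "n > 0"
  shows "0 < A n (1/3)" and "2 * (real n - 1/2) powr (1/3) \<le> 1 / A n (1/3)"
proof -
  have "(real n) powr (1/3) < (real n + 1/2) powr (1/3)"
    using assms by (intro powr_less_mono2) auto
  moreover have "0 < (real n + 1/2) powr (1/3)"
    by simp
  ultimately have "real n powr (1/3) < 2 * (real n + 1/2) powr (1/3)"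
    by linarith
  then have "1 / (2 * (real n + 1/2) powr (1/3)) < 1 / real n powr (1/3)"
    using assms by (intro divide_strict_left_mono) auto
  then show pos: "0 < A n (1/3)"
    using A_ge[of "1/3" n] assms by simp
  have "1 / (1 / (2 * (real n - 1/2) powr (1/3))) \<le> 1 / A n (1/3)"
    using A_le[of "1/3" n] assms pos by (intro divide_left_mono) auto
  then show "2 * (real n - 1/2) powr (1/3) \<le> 1 / A n (1/3)"
    by simp
qed

text \<open>The hypothesis says that \<open>m\<close> exceeds
  \<open>2 * (n - 1/2) powr (1/3)\<close>. As both sides are integers, it improves to
  \<open>8 * n \<le> m ^ 3 + 3\<close>, which replaces 1/2 by 3/8 and makes room for the error in
  \<open>A_ge\<close>.\<close>

lemma inverse_A_third_less:
  fixes m :: nat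
  assumes n: "n > 0" and m: "8 * n < m ^ 3 + 4"
  shows "1 / A n (1/3) < real m"
proof -
  have m0: "m > 0"
    using m n by (cases "m = 0") auto
  have A: "1 / real n powr (1/3) - 1 / (real n + 1/2) powr (1/3) / 2 \<le> A n (1/3)"
    using A_ge[of "1/3" n] n by simp
  have "1 / real m < A n (1/3)"
  proof (cases "n \<ge> 4")
    case True
    have "8 * (real n - 3/8) \<le> real m ^ 3"
    proof -
      have "8 * n \<le> m ^ 3 + 3" using m by simp
      then have "real (8 * n) \<le> real (m ^ 3 + 3)" by (rule of_nat_mono)
      then show ?thesis by simp
    qed
    also have "real m ^ 3 = 8 * (real m / 2) ^ 3"
      by (simp add: power_divide)
    finally have "((real n - 3/8) powr (1/3)) ^ 3 \<le> (real m / 2) ^ 3"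
      using True by (simp add: cube_powr_third)
    then have "(real n - 3/8) powr (1/3) \<le> real m / 2"
      by (rule power_mono_iff[THEN iffD1, rotated -1]) auto
    then have "1 / (real m / 2) \<le> 1 / (real n - 3/8) powr (1/3)"
      using True m0 by (intro divide_left_mono) auto
    then show ?thesis
      using A inverse_powr_third_add_less[of "real n"] True by simp
  next
    case False
    \<comment> \<open>Here \<open>m\<close> is at least 2, 3, 3 respectively, while the decimal
      bounds put \<open>A n (1/3)\<close> above 0.55, 0.35, 0.35.\<close>
    then consider "n = 1" | "n = 2" | "n = 3" using n by linarith
    then show ?thesis
    proof cases
      case 1
      have "m \<ge> 2"
        using m 1 by (cases "m = 1") (use m0 in auto)
      then have "1 / real m \<le> 1/2" by (simp add: field_simps)
      moreover have "1 / (real n + 1/2) powr (1/3) < 9/10"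
        by (rule inverse_powr_third_less) (auto simp: 1 power3_eq_cube)
      ultimately show ?thesis using A 1 by simp
    next
      case 2
      have "m \<ge> 3"
      proof (rule ccontr)
        assume "\<not> m \<ge> 3"
        then have "m ^ 3 \<le> 2 ^ 3" by (intro power_mono) auto
        then show False using m 2 by simp
      qed
      then have "1 / real m \<le> 1/3" by (simp add: field_simps)
      moreover have "1 / (real n + 1/2) powr (1/3) < 8/10"
        by (rule inverse_powr_third_less) (auto simp: 2 power3_eq_cube)
      moreover have "75/100 < 1 / real n powr (1/3)"
        by (rule less_inverse_powr_third) (auto simp: 2 power3_eq_cube)
      ultimately show ?thesis using A by simp
    next
      case 3
      have "m \<ge> 3"
      proof (rule ccontr)
        assume "\<not> m \<ge> 3"
        then have "m ^ 3 \<le> 2 ^ 3" by (intro power_mono) auto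
        then show False using m 3 by simp
      qed
      then have "1 / real m \<le> 1/3" by (simp add: field_simps)
      moreover have "1 / (real n + 1/2) powr (1/3) < 68/100"
        by (rule inverse_powr_third_less) (auto simp: 3 power3_eq_cube)
      moreover have "69/100 < 1 / real n powr (1/3)"
        by (rule less_inverse_powr_third) (auto simp: 3 power3_eq_cube)
      ultimately show ?thesis using A by simp
    qed
  qed
  then have "1 / A n (1/3) < 1 / (1 / real m)"
    using m0 A_third_pos_le(1)[OF n] by (intro divide_strict_left_mono) auto
  then show ?thesis by simp
qed

section \<open>Integrality and the passage to floors\<close>

text \<open>An even cube is divisible by 8, whereas \<open>8 * n - 4\<close> is 4 modulo 8. Hence
  \<open>2 * (n - 1/2) powr (1/3)\<close> is never an integer.\<close>

lemma cube_add_4_neq_8_mult: "m ^ 3 + 4 \<noteq> 8 * (n::nat)"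
proof
  assume eq: "m ^ 3 + 4 = 8 * n"
  then have "even (m ^ 3 + 4)" by simp
  then have "even m" by simp
  then obtain k where "m = 2 * k" by (elim evenE)
  then have "8 * k ^ 3 + 4 = 8 * n" using eq by (simp add: power_mult_distrib)
  then show False by presburger
qed

lemma inverse_A_third_less_of_le:
  fixes k :: int
  assumes n: "n > 0" and k: "2 * (real n - 1/2) powr (1/3) \<le> of_int k"
  shows "1 / A n (1/3) < of_int k"
proof -
  have "0 < 2 * (real n - 1/2) powr (1/3)" using n by simp
  with k have "0 < k" by linarith
  then obtain m where m: "k = int m"
    by (metis pos_int_cases)
  have "(2 * (real n - 1/2) powr (1/3)) ^ 3 \<le> real m ^ 3"
    using k m by (intro power_mono) auto
  then have "8 * real n \<le> real m ^ 3 + 4"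
    using n by (simp add: power_mult_distrib cube_powr_third)
  then have "real (8 * n) \<le> real (m ^ 3 + 4)" by simp
  then have "8 * n \<le> m ^ 3 + 4" by (simp only: of_nat_le_iff)
  then have "8 * n < m ^ 3 + 4"
    using cube_add_4_neq_8_mult[of m n] by simp
  then show ?thesis
    using inverse_A_third_less[OF n] m by simp
qed

theorem theorem2p10:
  shows "(\<forall>n::nat. n > 0 \<and> even n \<longrightarrow>
            \<lfloor>1 / A n (1/3)\<rfloor> = \<lfloor>2 * (real n - 1/2) powr (1/3)\<rfloor>) \<and>
         (\<forall>n::nat. n > 0 \<and> odd n \<longrightarrow>
            \<lfloor>1 / B n (1/3)\<rfloor> = \<lfloor>- 2 * (real n - 1/2) powr (1/3)\<rfloor>)"
proof (intro conjI allI impI; elim conjE)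
  fix n :: nat assume n: "n > 0"
  define r where "r = 2 * (real n - 1/2) powr (1/3)"
  have le: "r \<le> 1 / A n (1/3)"
    using A_third_pos_le(2)[OF n] by (simp add: r_def)
  have less: "1 / A n (1/3) < of_int k" if "r \<le> of_int k" for k
    using inverse_A_third_less_of_le[OF n] that by (simp add: r_def)
  have "\<lfloor>1 / A n (1/3)\<rfloor> = \<lfloor>r\<rfloor>"
    \<comment> \<open>The integer just above \<open>r\<close> also lies above
      \<open>1 / A n (1/3)\<close>.\<close>
    using floor_mono[OF le] less[of "\<lfloor>r\<rfloor> + 1"] by (intro antisym) linarith+
  then show "\<lfloor>1 / A n (1/3)\<rfloor> = \<lfloor>2 * (real n - 1/2) powr (1/3)\<rfloor>"
    by (simp add: r_def)
  \<comment> \<open>Since \<open>B\<close> is \<open>- A\<close>, its floor is a negated ceiling.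
    Taking \<open>k\<close> to be the ceiling of \<open>r\<close> gives only
    \<open>r \<le> k\<close>, which is why \<open>less\<close> starts from a weak
    inequality.\<close>
  have "\<lceil>1 / A n (1/3)\<rceil> = \<lceil>r\<rceil>"
    using ceiling_mono[OF le] less[of "\<lceil>r\<rceil>"] by (intro antisym) linarith+
  then show "\<lfloor>1 / B n (1/3)\<rfloor> = \<lfloor>- 2 * (real n - 1/2) powr (1/3)\<rfloor>"
    using n by (simp add: B_eq_uminus_A r_def ceiling_def)
qed

end
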